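(* For every fixed integer $r\ge 8$, $$\sup_{\mathsf r(G)=r}\delta(G)=\infty,$$ where the supremum is taken over all finite abelian groups $G$ of rank $r$. Consequently, there is no function $f:\mathbb N\to[0,\infty)$ such that $\delta(G)\le f(\mathsf r(G))$ for every nontrivial finite abelian group $G$, and $\sup_G \delta(G)/\mathsf r(G)=\infty$ even when the supremum is restricted to groups of rank eight. Moreover, for all integers $r\ge 8$ and $m\ge 2$ with $m\ge r$, the group $G_{m,r}=C_m^{\,r-5}\oplus C_{2m}^{\,4}\oplus C_{6m}$ (which has rank $r$) violates the inequality $\delta(G)\le \mathsf r(G)-1$; that is, $\delta(G_{m,r})>r-1$.
   Context: All groups are finite, abelian and written additively; $C_n$ denotes the cyclic group of order $n$. The rank $\mathsf r(G)$ is the minimum number of generators of $G$. A sequence over $G$ is a finite unordered multiset of elements of $G$; its length counts multiplicity. A sequence is zero-sum free if it has no nonempty subsequence (sub-multiset) whose terms sum to $0$. $\mathsf d(G)$ is the maximum length of a zero-sum-free sequence over $G$. If $G\cong C_{n_1}\oplus\cdots\oplus C_{n_s}$ with $1<n_1\mid\cdots\mid n_s$, then $\mathsf d^*(G)=\sum_{i=1}^s(n_i-1)$. The Davenport excess of a nontrivial group is $\delta(G)=\mathsf d(G)-\mathsf d^*(G)$. *)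

theory Defs
  imports "HOL-Algebra.Algebra" "HOL-Library.Multiset" "HOL-Library.Extended_Real"
begin

text \<open>
  Abelian groups are the multiplicatively written groups of \<^locale>\<open>comm_group\<close>; the ``sum'' of
  a sequence is thus a product, and ``zero'' is \<open>\<one>\<close>. In particular
  \<^const>\<open>integer_mod_group\<close> \<open>n\<close> is the additive group of integers modulo \<open>n\<close>.
\<close>

text \<open>
  A class of groups cannot be quantified over all carrier types at once. As every finite
  group is isomorphic to one whose carrier is a set of natural numbers (see
  \<open>finite_group_iso_nat\<close>) and all invariants below depend only on the isomorphism class,
  \<open>fin_ab_groups\<close> stands for the class of all finite abelian groups.
\<close>

definition fin_ab_groups :: "nat monoid set" where
  "fin_ab_groups = {G. comm_group G \<and> finite (carrier G)}"

lemma finite_group_iso_nat: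
  fixes G :: "'a monoid" (structure)
  assumes "comm_group G" "finite (carrier G)"
  shows "\<exists>H \<in> fin_ab_groups. G \<cong> H"
proof -
  interpret comm_group G by fact
  obtain h :: "'a \<Rightarrow> nat" where h: "inj_on h (carrier G)"
    using finite_imp_inj_to_nat_seg[OF assms(2)] by blast
  define k where "k = inv_into (carrier G) h"
  have k [simp]: "k (h x) = x" if "x \<in> carrier G" for x
    using h that by (simp add: k_def)
  define H :: "nat monoid" where
    "H = \<lparr>carrier = h ` carrier G, monoid.mult = (\<lambda>x y. h (k x \<otimes> k y)), one = h \<one>\<rparr>"
  have H: "comm_group H"
  proof (rule comm_groupI)
    fix x assume "x \<in> carrier H"
    then obtain a where a: "a \<in> carrier G" "x = h a" by (auto simp: H_def)
    then have "h (inv a) \<in> carrier H" "h (inv a) \<otimes>\<^bsub>H\<^esub> x = \<one>\<^bsub>H\<^esub>"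
      by (auto simp: H_def)
    then show "\<exists>y\<in>carrier H. y \<otimes>\<^bsub>H\<^esub> x = \<one>\<^bsub>H\<^esub>" by blast
  qed (auto simp: H_def m_assoc m_lcomm m_comm)
  have "h \<in> iso G H"
    using h by (auto simp: iso_def hom_def H_def bij_betw_def)
  moreover have "H \<in> fin_ab_groups"
    using H assms(2) by (simp add: fin_ab_groups_def) (simp add: H_def)
  ultimately show ?thesis by (auto simp: is_iso_def)
qed

definition rank :: "('a, 'b) monoid_scheme \<Rightarrow> nat" where
  "rank G = (LEAST k. \<exists>S \<subseteq> carrier G. finite S \<and> card S = k \<and> generate G S = carrier G)"

definition seq_sum :: "('a, 'b) monoid_scheme \<Rightarrow> 'a multiset \<Rightarrow> 'a" where
  "seq_sum G S = (\<Otimes>\<^bsub>G\<^esub>x\<in>set_mset S. x [^]\<^bsub>G\<^esub> count S x)"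

definition zero_sum_free :: "('a, 'b) monoid_scheme \<Rightarrow> 'a multiset \<Rightarrow> bool" where
  "zero_sum_free G S \<longleftrightarrow>
     set_mset S \<subseteq> carrier G \<and> (\<forall>T. T \<subseteq># S \<and> T \<noteq> {#} \<longrightarrow> seq_sum G T \<noteq> \<one>\<^bsub>G\<^esub>)"

text \<open>
  For a finite group the lengths of zero-sum free sequences are bounded (by \<open>order G - 1\<close>),
  so the maximum is taken over a finite nonempty set.
\<close>

definition small_davenport :: "('a, 'b) monoid_scheme \<Rightarrow> nat" where
  "small_davenport G = Max {size S | S. zero_sum_free G S}"

definition cyclic_sum :: "nat list \<Rightarrow> (nat \<Rightarrow> int) monoid" where
  "cyclic_sum ns = product_group {..<length ns} (\<lambda>i. integer_mod_group (ns ! i))"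

definition is_invariant_factors :: "('a, 'b) monoid_scheme \<Rightarrow> nat list \<Rightarrow> bool" where
  "is_invariant_factors G ns \<longleftrightarrow>
     (\<forall>n \<in> set ns. 1 < n) \<and> sorted_wrt (dvd) ns \<and> G \<cong> cyclic_sum ns"

text \<open>
  The list of invariant factors of a finite abelian group exists and is unique, so the
  description below denotes.
\<close>

definition d_star :: "('a, 'b) monoid_scheme \<Rightarrow> nat" where
  "d_star G = (\<Sum>n\<leftarrow>(THE ns. is_invariant_factors G ns). n - 1)"

definition davenport_excess :: "('a, 'b) monoid_scheme \<Rightarrow> int" where
  "davenport_excess G = int (small_davenport G) - int (d_star G)"

definition G_mr :: "nat \<Rightarrow> nat \<Rightarrow> (nat \<Rightarrow> int) monoid" where
  "G_mr m r = cyclic_sum (replicate (r - 5) m @ replicate 4 (2 * m) @ [6 * m])"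

end

theory Submission
  imports Defs "HOL-Number_Theory.Cong"
begin

text \<open>
  Let \<open>Q = C\<^sub>2\<^sup>4 \<oplus> C\<^sub>6\<close>, let \<open>v\<^sub>1, \<dots>, v\<^sub>7 \<in> C\<^sub>2\<^sup>4\<close> be the columns of a generator matrix of the Hamming code
  and take the sequence over \<open>Q\<close> consisting of \<open>(v\<^sub>1, 2), \<dots>, (v\<^sub>7, 2)\<close> and three times \<open>(0, 1)\<close>. It is
  zero-sum free: the relations between the \<open>v\<^sub>i\<close> form the simplex code, whose nonzero words have
  weight 4, so that a subsum with vanishing \<open>C\<^sub>2\<^sup>4\<close> part lies in \<open>{0, \<dots>, 3} \<union> {8, \<dots>, 11}\<close> modulo 6. Its
  length \<open>10\<close> is \<open>d\<^sup>* + 1\<close>, and it has only eight distinct terms.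

  Let \<open>L \<subseteq> \<int>\<^sup>r\<close>, \<open>r \<ge> 8\<close>, be the lattice of relations between these eight elements and \<open>r - 8\<close> zeros.
  Then \<open>\<int>\<^sup>r / L \<cong> Q\<close>, hence \<open>\<int>\<^sup>r / mL\<close> is \<open>G_mr m r\<close>. If \<open>L\<close> meets the box of the vectors with
  \<open>0 \<le> x\<^sub>j \<le> c\<^sub>j\<close> only in 0, then \<open>mL\<close> meets the larger box \<open>0 \<le> x\<^sub>j \<le> m c\<^sub>j + m - 1\<close> only in 0. This
  is a zero-sum free sequence over \<open>G_mr m r\<close> of length \<open>10 m + r (m - 1) = d\<^sup>* + m\<close>, so the excess is at
  least \<open>m\<close> while the rank is \<open>r\<close>.
\<close>

subsection \<open>Zero-sum free sequences\<close>

text \<open>Allowing any finite index set above the support lets the sums of two sequences be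
  compared over one common set.\<close>

lemma (in comm_group) seq_sum_superset:
  assumes "finite B" "set_mset T \<subseteq> B" "B \<subseteq> carrier G"
  shows "seq_sum G T = (\<Otimes>x\<in>B. x [^] count T x)"
  unfolding seq_sum_def
  by (rule finprod_mono_neutral_cong_left) (use assms in \<open>auto simp: not_in_iff\<close>)

lemma (in comm_group) seq_sum_closed:
  "set_mset T \<subseteq> carrier G \<Longrightarrow> seq_sum G T \<in> carrier G"
  unfolding seq_sum_def by (rule finprod_closed) auto

lemma (in comm_group) seq_sum_empty [simp]: "seq_sum G {#} = \<one>"
  by (simp add: seq_sum_def)

lemma (in comm_group) seq_sum_add_mset:
  assumes x: "x \<in> carrier G" and T: "set_mset T \<subseteq> carrier G"
  shows "seq_sum G (add_mset x T) = x \<otimes> seq_sum G T"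
proof -
  define B where "B = insert x (set_mset T)"
  have B: "finite B" "set_mset T \<subseteq> B" "x \<in> B" "B \<subseteq> carrier G"
    using assms by (auto simp: B_def)
  have "seq_sum G (add_mset x T) = (\<Otimes>y\<in>B. y [^] count (add_mset x T) y)"
    using B by (intro seq_sum_superset) auto
  \<comment> \<open>The exponent grows by one at \<open>x\<close> only, which splits off a product
    with the single nontrivial factor \<open>x\<close>.\<close>
  also have "\<dots> = (\<Otimes>y\<in>B. (if y = x then y else \<one>) \<otimes> y [^] count T y)"
    by (rule finprod_cong') (use B in \<open>auto simp: m_comm subset_iff\<close>)
  also have "\<dots> = (\<Otimes>y\<in>B. if y = x then y else \<one>) \<otimes> (\<Otimes>y\<in>B. y [^] count T y)"
    using B by (intro finprod_multf) auto
  also have "(\<Otimes>y\<in>B. if y = x then y else \<one>) = x"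
    using B by (intro finprod_singleton_swap) auto
  also have "(\<Otimes>y\<in>B. y [^] count T y) = seq_sum G T"
    using B by (intro seq_sum_superset [symmetric]) auto
  finally show ?thesis .
qed

lemma (in comm_group) seq_sum_union:
  assumes "set_mset S \<subseteq> carrier G" "set_mset T \<subseteq> carrier G"
  shows "seq_sum G (S + T) = seq_sum G S \<otimes> seq_sum G T"
  using assms
  by (induction S) (auto simp: seq_sum_add_mset seq_sum_closed m_assoc)

text \<open>Two of the partial sums of a long sequence agree, and their difference is a zero sum.\<close>

lemma (in comm_group) zero_sum_free_size_le:
  assumes fin: "finite (carrier G)" and S: "zero_sum_free G S"
  shows "size S \<le> card (carrier G)"
proof (rule ccontr)
  assume *: "\<not> size S \<le> card (carrier G)"
  obtain xs where xs: "mset xs = S" using ex_mset by blast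
  have xs_carr: "set xs \<subseteq> carrier G"
    using S xs by (auto simp: zero_sum_free_def)
  define p where "p k = seq_sum G (mset (take k xs))" for k
  have sub: "set_mset (mset (take k xs)) \<subseteq> carrier G" for k
    using xs_carr set_take_subset[of k xs] by auto
  have "p ` {..size S} \<subseteq> carrier G"
    using seq_sum_closed[OF sub] by (auto simp: p_def)
  then have "card (p ` {..size S}) \<le> card (carrier G)"
    using fin by (simp add: card_mono)
  then have "\<not> inj_on p {..size S}"
    using * by (intro pigeonhole) simp
  then obtain k l where kl: "k < l" "l \<le> size S" "p k = p l"
    by (auto simp: inj_on_def) (metis linorder_neqE_nat)
  define T where "T = mset (drop k (take l xs))"
  have "mset (take l xs) = mset (take k xs) + T"
    unfolding T_def using kl(1)
    by (metis append_take_drop_id min.absorb1 mset_append nat_less_le take_take)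
  moreover have T: "set_mset T \<subseteq> carrier G"
    unfolding T_def using xs_carr by (auto dest!: in_set_dropD in_set_takeD)
  ultimately have "p k = p k \<otimes> seq_sum G T"
    using seq_sum_union[OF sub[of k] T] kl(3) by (simp add: p_def)
  then have "seq_sum G T = \<one>"
    using seq_sum_closed[OF sub[of k]] seq_sum_closed[OF T]
    by (simp add: p_def r_cancel_one')
  moreover have "T \<subseteq># S"
    unfolding T_def xs[symmetric]
    by (metis append_take_drop_id mset_append mset_subset_eq_add_right subset_mset.order_trans mset_subset_eq_add_left)
  moreover have "T \<noteq> {#}"
    using kl xs by (auto simp: T_def)
  ultimately show False
    using S by (auto simp: zero_sum_free_def)
qed

lemma (in comm_group) small_davenport_ge:
  assumes "finite (carrier G)" "zero_sum_free G S"
  shows "size S \<le> small_davenport G"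
  unfolding small_davenport_def
proof (rule Max_ge)
  have "{size S |S. zero_sum_free G S} \<subseteq> {..card (carrier G)}"
    using zero_sum_free_size_le[OF assms(1)] by auto
  then show "finite {size S |S. zero_sum_free G S}"
    by (rule finite_subset) simp
qed (use assms in auto)

section \<open>Transport of sequences along isomorphisms\<close>

lemma seq_sum_image_iso:
  assumes "comm_group G" "comm_group H" "\<phi> \<in> iso G H" "set_mset T \<subseteq> carrier G"
  shows "seq_sum H (image_mset \<phi> T) = \<phi> (seq_sum G T)"
proof -
  interpret G: comm_group G by fact
  interpret H: comm_group H by fact
  have hom: "\<phi> \<in> hom G H" using assms(3) by (simp add: iso_def)
  show ?thesis
    using assms(4)
  proof (induction T)
    case empty
    show ?case
      using hom_one[OF hom G.is_group H.is_group] by simp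
  next
    case (add x T)
    have "set_mset (image_mset \<phi> T) \<subseteq> carrier H" "\<phi> x \<in> carrier H"
      using add.prems hom by (auto simp: hom_def)
    then show ?case
      using add hom by (simp add: H.seq_sum_add_mset G.seq_sum_add_mset G.seq_sum_closed hom_mult)
  qed
qed

lemma zero_sum_free_image_iso:
  assumes G: "comm_group G" and H: "comm_group H" and iso: "\<phi> \<in> iso G H" and S: "zero_sum_free G S"
  shows "zero_sum_free H (image_mset \<phi> S)"
  unfolding zero_sum_free_def
proof (intro conjI allI impI)
  interpret G: comm_group G by fact
  interpret H: comm_group H by fact
  have hom: "\<phi> \<in> hom G H" and inj: "inj_on \<phi> (carrier G)"
    using iso by (auto simp: iso_def bij_betw_def)
  have S_carr: "set_mset S \<subseteq> carrier G" using S by (simp add: zero_sum_free_def)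
  then show "set_mset (image_mset \<phi> S) \<subseteq> carrier H"
    using hom by (auto simp: hom_def)
  fix T assume "T \<subseteq># image_mset \<phi> S \<and> T \<noteq> {#}"
  then obtain U where U: "T = image_mset \<phi> U" "U \<subseteq># S" "U \<noteq> {#}"
    by (metis image_mset_is_empty_iff mset_subset_eq_exists_conv image_mset_eq_plusD mset_subset_eq_add_left)
  have U_carr: "set_mset U \<subseteq> carrier G"
    using U(2) S_carr set_mset_mono by blast
  have "seq_sum G U \<noteq> \<one>\<^bsub>G\<^esub>"
    using S U by (auto simp: zero_sum_free_def)
  then have "\<phi> (seq_sum G U) \<noteq> \<phi> \<one>\<^bsub>G\<^esub>"
    using inj G.seq_sum_closed[OF U_carr] by (auto simp: inj_on_def)
  then show "seq_sum H T \<noteq> \<one>\<^bsub>H\<^esub>"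
    using seq_sum_image_iso[OF G H iso U_carr] hom_one[OF hom G.is_group H.is_group] U(1) by simp
qed

subsection \<open>Rank and invariant factors\<close>

lemma rank_le:
  assumes "S \<subseteq> carrier G" "finite S" "generate G S = carrier G"
  shows "rank G \<le> card S"
  unfolding rank_def by (rule Least_le) (use assms in auto)

lemma (in group) rank_witness:
  assumes "finite (carrier G)"
  obtains S where "S \<subseteq> carrier G" "finite S" "card S = rank G" "generate G S = carrier G"
proof -
  have "generate G (carrier G) = carrier G"
    using generate_incl[of "carrier G"] by (auto intro: generate.incl)
  then have "\<exists>k. \<exists>S \<subseteq> carrier G. finite S \<and> card S = k \<and> generate G S = carrier G"
    using assms by auto
  from LeastI_ex[OF this] show ?thesis
    using that by (auto simp: rank_def)
qed

lemma rank_iso_le: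
  assumes "group G" "group H" "G \<cong> H" "finite (carrier G)"
  shows "rank H \<le> rank G"
proof -
  obtain \<phi> where \<phi>: "\<phi> \<in> hom G H" "\<phi> ` carrier G = carrier H"
    using assms(3) by (auto simp: is_iso_def iso_def bij_betw_def)
  interpret group_hom G H \<phi>
    using assms \<phi> by (simp add: group_hom_def group_hom_axioms_def)
  obtain S where S: "S \<subseteq> carrier G" "finite S" "card S = rank G" "generate G S = carrier G"
    using G.rank_witness[OF assms(4)] by blast
  have "generate H (\<phi> ` S) = carrier H"
    using generate_img[OF S(1)] S(4) \<phi>(2) by simp
  then have "rank H \<le> card (\<phi> ` S)"
    using S \<phi> by (intro rank_le) auto
  also have "\<dots> \<le> rank G"
    using card_image_le[OF S(2)] S(3) by simp
  finally show ?thesis .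
qed

lemma rank_iso:
  assumes "group G" "group H" "G \<cong> H" "finite (carrier G)"
  shows "rank G = rank H"
  using assms rank_iso_le[of G H] rank_iso_le[of H G] group.iso_sym iso_finite
  by (metis order_antisym)

lemma (in group) rank_trivial:
  assumes "trivial_group G"
  shows "rank G = 0"
  using rank_le[of "{}" G] assms generate_empty by (simp add: trivial_group_def)

lemma is_invariant_factors_iso:
  assumes "group G" "group H" "G \<cong> H"
  shows "is_invariant_factors G ns \<longleftrightarrow> is_invariant_factors H ns"
  unfolding is_invariant_factors_def
  using assms by (meson group.iso_sym iso_trans)

section \<open>Coordinatewise arithmetic in direct sums of cyclic groups\<close>

lemma carrier_cyclic_sum:
  assumes "\<forall>n\<in>set ns. 0 < n"
  shows "carrier (cyclic_sum ns) = (\<Pi>\<^sub>E i\<in>{..<length ns}. {0..<int (ns ! i)})"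
proof -
  have "carrier (cyclic_sum ns) = (\<Pi>\<^sub>E i\<in>{..<length ns}. carrier (integer_mod_group (ns ! i)))"
    by (simp add: cyclic_sum_def)
  also have "\<dots> = (\<Pi>\<^sub>E i\<in>{..<length ns}. {0..<int (ns ! i)})"
  proof (rule PiE_cong)
    fix i assume "i \<in> {..<length ns}"
    then show "carrier (integer_mod_group (ns ! i)) = {0..<int (ns ! i)}"
      using assms by (auto simp: carrier_integer_mod_group dest: nth_mem)
  qed
  finally show ?thesis .
qed

lemma one_cyclic_sum: "\<one>\<^bsub>cyclic_sum ns\<^esub> = (\<lambda>i\<in>{..<length ns}. 0)"
  by (simp add: cyclic_sum_def)

lemma mult_cyclic_sum:
  "x \<otimes>\<^bsub>cyclic_sum ns\<^esub> y = (\<lambda>i\<in>{..<length ns}. (x i + y i) mod int (ns ! i))"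
  by (simp add: cyclic_sum_def)

lemma comm_group_cyclic_sum: "comm_group (cyclic_sum ns)"
proof (rule group.group_comm_groupI)
  show "group (cyclic_sum ns)" by (simp add: cyclic_sum_def)
qed (simp add: mult_cyclic_sum add.commute)

lemma finite_cyclic_sum:
  assumes "\<forall>n\<in>set ns. 0 < n"
  shows "finite (carrier (cyclic_sum ns))"
  using assms by (simp add: carrier_cyclic_sum finite_PiE)

lemma cyclic_sum_elem:
  assumes "\<forall>n\<in>set ns. 0 < n" "x \<in> carrier (cyclic_sum ns)" "i < length ns"
  shows "0 \<le> x i" "x i < int (ns ! i)"
  using assms by (auto simp: carrier_cyclic_sum PiE_iff)

lemma cyclic_sum_eqI:
  assumes "x \<in> carrier (cyclic_sum ns)" "y \<in> carrier (cyclic_sum ns)"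
    and "\<And>i. i < length ns \<Longrightarrow> x i = y i"
  shows "x = y"
  using assms by (intro PiE_ext[of x "{..<length ns}"]) (auto simp: cyclic_sum_def)

lemma inv_cyclic_sum:
  assumes "x \<in> carrier (cyclic_sum ns)" "i < length ns"
  shows "(inv\<^bsub>cyclic_sum ns\<^esub> x) i = (- x i) mod int (ns ! i)"
  using assms by (auto simp: cyclic_sum_def PiE_iff)

lemma pow_cyclic_sum:
  assumes "x \<in> carrier (cyclic_sum ns)" "i < length ns"
  shows "(x [^]\<^bsub>cyclic_sum ns\<^esub> (k::nat)) i = (int k * x i) mod int (ns ! i)"
proof (induction k)
  case 0
  then show ?case using assms by (simp add: one_cyclic_sum)
next
  case (Suc k)
  then show ?case using assms
    by (simp add: mult_cyclic_sum mod_add_right_eq distrib_right add.commute)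
qed

section \<open>Sequences over direct sums of cyclic groups\<close>

lemma seq_sum_cyclic_sum:
  assumes "set_mset T \<subseteq> carrier (cyclic_sum ns)" "i < length ns"
  shows "seq_sum (cyclic_sum ns) T i = (\<Sum>x\<in>#T. x i) mod int (ns ! i)"
proof -
  interpret comm_group "cyclic_sum ns" by (rule comm_group_cyclic_sum)
  show ?thesis
    using assms
    by (induction T) (auto simp: one_cyclic_sum mult_cyclic_sum seq_sum_add_mset mod_add_right_eq)
qed

text \<open>The \<open>w j\<close> need not be distinct, so the \<open>a j\<close> cannot be read
  off as multiplicities. They are chosen one index at a time, each \<open>w k\<close> taking as many
  copies as \<open>M k\<close> allows.\<close>

lemma subseteq_sum_replicate_msetE:
  assumes "finite A" "T \<subseteq># (\<Sum>j\<in>A. replicate_mset (M j) (w j))"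
  obtains a where "\<forall>j\<in>A. a j \<le> M j" "T = (\<Sum>j\<in>A. replicate_mset (a j) (w j))"
proof -
  have "\<exists>a. (\<forall>j\<in>A. a j \<le> M j) \<and> T = (\<Sum>j\<in>A. replicate_mset (a j) (w j))"
    using assms
  proof (induction A arbitrary: T rule: finite_induct)
    case (insert k A)
    let ?R = "replicate_mset (M k) (w k)"
    have "T - ?R \<subseteq># (\<Sum>j\<in>A. replicate_mset (M j) (w j))"
      using insert.prems insert.hyps by (simp add: subset_eq_diff_conv add.commute[of _ ?R])
    then obtain a where a: "\<forall>j\<in>A. a j \<le> M j" "T - ?R = (\<Sum>j\<in>A. replicate_mset (a j) (w j))"
      using insert.IH by blast
    have "T \<inter># ?R \<subseteq># ?R" by simp
    then obtain l where l: "l \<le> M k" "T \<inter># ?R = replicate_mset l (w k)"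
      by (rule msubseteq_replicate_msetE)
    have "T = (T \<inter># ?R) + (T - ?R)"
      by (rule multiset_eqI) (simp add: min_def)
    also have "T - ?R = (\<Sum>j\<in>A. replicate_mset ((a(k := l)) j) (w j))"
      unfolding a(2) using insert.hyps(2) by (intro sum.cong) auto
    also have "(T \<inter># ?R) + \<dots> = (\<Sum>j\<in>insert k A. replicate_mset ((a(k := l)) j) (w j))"
      using insert.hyps l(2) by simp
    finally have "T = (\<Sum>j\<in>insert k A. replicate_mset ((a(k := l)) j) (w j))" .
    moreover have "\<forall>j\<in>insert k A. (a(k := l)) j \<le> M j"
      using a(1) l(1) by simp
    ultimately show ?case by blast
  qed simp
  then show ?thesis using that by blast
qed

text \<open>Passage from sequences to integer vectors: subsequences are vectors \<open>a\<close> in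
  the box bounded by \<open>M\<close>, zero sums are relations between the \<open>w j\<close>, and
  \<open>free\<close> says that the box contains no relation but 0.\<close>

lemma zero_sum_free_cyclic_sum:
  fixes k :: nat
  assumes w: "\<And>j. j < k \<Longrightarrow> w j \<in> carrier (cyclic_sum ns)"
    and free: "\<And>a. \<lbrakk>\<forall>j<k. a j \<le> M j; \<forall>i<length ns. int (ns ! i) dvd (\<Sum>j<k. int (a j) * w j i)\<rbrakk>
      \<Longrightarrow> \<forall>j<k. a j = 0"
  shows "zero_sum_free (cyclic_sum ns) (\<Sum>j<k. replicate_mset (M j) (w j))"
  unfolding zero_sum_free_def
proof (intro conjI allI impI)
  show S: "set_mset (\<Sum>j<k. replicate_mset (M j) (w j)) \<subseteq> carrier (cyclic_sum ns)"
    using w by (auto simp: set_mset_sum split: if_splits)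
  fix T assume T: "T \<subseteq># (\<Sum>j<k. replicate_mset (M j) (w j)) \<and> T \<noteq> {#}"
  then obtain a where a: "\<forall>j\<in>{..<k}. a j \<le> M j" "T = (\<Sum>j<k. replicate_mset (a j) (w j))"
    by (elim conjE subseteq_sum_replicate_msetE[rotated]) auto
  show "seq_sum (cyclic_sum ns) T \<noteq> \<one>\<^bsub>cyclic_sum ns\<^esub>"
  proof
    assume one: "seq_sum (cyclic_sum ns) T = \<one>\<^bsub>cyclic_sum ns\<^esub>"
    have T_carr: "set_mset T \<subseteq> carrier (cyclic_sum ns)"
      using T S set_mset_mono by blast
    have sum_eq: "(\<Sum>x\<in>#(\<Sum>j<l. replicate_mset (a j) (w j)). x i) = (\<Sum>j<l. int (a j) * w j i)" for i l
      by (induction l) auto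
    have "\<forall>i<length ns. int (ns ! i) dvd (\<Sum>j<k. int (a j) * w j i)"
      using seq_sum_cyclic_sum[OF T_carr] one sum_eq a(2)
      by (simp add: one_cyclic_sum mod_eq_0_iff_dvd)
    then have "\<forall>j<k. a j = 0" using free a(1) by auto
    then show False using T a(2) by simp
  qed
qed

section \<open>The rank of a direct sum of cyclic groups\<close>

lemma rank_cyclic_sum_le:
  assumes pos: "\<forall>n\<in>set ns. 1 < n"
  shows "rank (cyclic_sum ns) \<le> length ns"
proof -
  let ?G = "cyclic_sum ns"
  interpret comm_group ?G by (rule comm_group_cyclic_sum)
  have pos': "\<forall>n\<in>set ns. 0 < n" using pos by auto
  define e where "e j = (\<lambda>i\<in>{..<length ns}. if i = j then 1 else 0 :: int)" for j
  have e: "e j \<in> carrier ?G" if "j < length ns" for j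
    using pos pos' nth_mem[of _ ns] by (auto simp: e_def carrier_cyclic_sum)
  let ?S = "e ` {..<length ns}"
  have S: "?S \<subseteq> carrier ?G" using e by auto
  \<comment> \<open>Induction on \<open>k\<close>, where \<open>x\<close> vanishes from coordinate
    \<open>k\<close> on: the last coordinate left is removed by a power of a unit vector.\<close>
  have gen: "x \<in> generate ?G ?S"
    if "x \<in> carrier ?G" "\<forall>i<length ns. k \<le> i \<longrightarrow> x i = 0" "k \<le> length ns" for x k
    using that
  proof (induction k arbitrary: x)
    case 0
    then have "x = \<one>\<^bsub>?G\<^esub>"
      by (intro cyclic_sum_eqI[OF _ one_closed]) (auto simp: one_cyclic_sum)
    then show ?case by (simp add: generate.one)
  next
    case (Suc k)
    define y where "y = (\<lambda>i\<in>{..<length ns}. if i = k then 0 else x i)"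
    have y: "y \<in> carrier ?G"
      using Suc.prems(1) pos' by (auto simp: y_def carrier_cyclic_sum PiE_iff)
    have y_gen: "y \<in> generate ?G ?S"
      by (rule Suc.IH[OF y]) (use Suc.prems in \<open>auto simp: y_def\<close>)
    have k_lt: "k < length ns" using Suc.prems(3) by simp
    have pow_gen: "e k [^]\<^bsub>?G\<^esub> (l::nat) \<in> generate ?G ?S" for l
    proof (induction l)
      case (Suc l)
      moreover have "e k \<in> generate ?G ?S" using k_lt by (intro generate.incl) auto
      ultimately show ?case by (simp add: generate.eng)
    qed (simp add: generate.one)
    have x_eq: "x = y \<otimes>\<^bsub>?G\<^esub> e k [^]\<^bsub>?G\<^esub> nat (x k)"
    proof (rule cyclic_sum_eqI[OF Suc.prems(1)])
      fix i assume i: "i < length ns"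
      have "x i = (y i + int (nat (x k)) * e k i mod int (ns ! i)) mod int (ns ! i)"
        using i k_lt cyclic_sum_elem[OF pos' Suc.prems(1)] by (auto simp: y_def e_def)
      then show "x i = (y \<otimes>\<^bsub>?G\<^esub> e k [^]\<^bsub>?G\<^esub> nat (x k)) i"
        using i pow_cyclic_sum[OF e[OF k_lt] i] by (simp add: mult_cyclic_sum)
    qed (use y e[OF k_lt] in simp)
    show ?case by (subst x_eq) (rule generate.eng[OF y_gen pow_gen])
  qed
  have "generate ?G ?S = carrier ?G"
    using gen[of _ "length ns"] generate_incl[OF S] by auto
  then have "rank ?G \<le> card ?S" using S by (intro rank_le) auto
  also have "\<dots> \<le> length ns" using card_image_le[of "{..<length ns}" e] by simp
  finally show ?thesis .
qed

text \<open>
  Modulo a common divisor \<open>p\<close> of the orders, the coordinates of an element depend only on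
  the exponents modulo \<open>p\<close> of the generators in a word for it.
\<close>

lemma rank_cyclic_sum_ge:
  assumes pos: "\<forall>n\<in>set ns. 0 < n" and p: "1 < p" "\<forall>n\<in>set ns. p dvd n"
  shows "length ns \<le> rank (cyclic_sum ns)"
proof -
  let ?G = "cyclic_sum ns" and ?r = "length ns"
  interpret comm_group ?G by (rule comm_group_cyclic_sum)
  obtain S where S: "S \<subseteq> carrier ?G" "finite S" "card S = rank ?G" "generate ?G S = carrier ?G"
    using rank_witness[OF finite_cyclic_sum[OF pos]] by blast
  have dvd: "int p dvd int (ns ! i)" if "i < ?r" for i
    using p(2) that by (simp add: nth_mem)
  have word: "\<exists>a. \<forall>i<?r. [x i = (\<Sum>s\<in>S. a s * s i)] (mod int p)" if "x \<in> generate ?G S" for x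
    using that
  proof (induction rule: generate.induct)
    case one
    show ?case by (rule exI[of _ "\<lambda>_. 0"]) (simp add: one_cyclic_sum)
  next
    case (incl h)
    have "(\<Sum>s\<in>S. (if s = h then 1 else 0) * s i) = h i" for i
    proof -
      have "(\<Sum>s\<in>S. (if s = h then 1 else 0) * s i) = (\<Sum>s\<in>S. if s = h then s i else 0)"
        by (rule sum.cong) auto
      then show ?thesis using S(2) incl by simp
    qed
    then show ?case by (intro exI[of _ "\<lambda>s. if s = h then 1 else 0"]) simp
  next
    case (inv h)
    have "(\<Sum>s\<in>S. (if s = h then -1 else 0) * s i) = - h i" for i
    proof -
      have "(\<Sum>s\<in>S. (if s = h then -1 else 0) * s i) = (\<Sum>s\<in>S. if s = h then - s i else 0)"
        by (rule sum.cong) auto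
      then show ?thesis using S(2) inv by simp
    qed
    \<comment> \<open>Reduction modulo \<open>ns ! i\<close> is invisible modulo its divisor
      \<open>p\<close>.\<close>
    moreover have "[(inv\<^bsub>?G\<^esub> h) i = - h i] (mod int p)" if "i < ?r" for i
      using inv_cyclic_sum[of h ns i] inv S(1) dvd[OF that] that
      by (auto simp: cong_def mod_mod_cancel)
    ultimately show ?case by (intro exI[of _ "\<lambda>s. if s = h then -1 else 0"]) simp
  next
    case (eng h1 h2)
    then obtain a b where
      "\<forall>i<?r. [h1 i = (\<Sum>s\<in>S. a s * s i)] (mod int p)" "\<forall>i<?r. [h2 i = (\<Sum>s\<in>S. b s * s i)] (mod int p)"
      by blast
    then have sum_cong: "[h1 i + h2 i = (\<Sum>s\<in>S. (a s + b s) * s i)] (mod int p)" if "i < ?r" for i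
      using that by (simp add: distrib_right sum.distrib cong_add)
    have mult_cong: "[(h1 \<otimes>\<^bsub>?G\<^esub> h2) i = h1 i + h2 i] (mod int p)" if "i < ?r" for i
      using dvd[OF that] that by (simp add: mult_cyclic_sum cong_def mod_mod_cancel)
    show ?case
      by (intro exI allI impI) (rule cong_trans[OF mult_cong sum_cong])
  qed
  \<comment> \<open>\<open>F\<close> sends exponents modulo \<open>p\<close> to coordinates modulo
    \<open>p\<close>. It is onto by \<open>word\<close>, so counting bounds \<open>p ^ ?r\<close> by
    \<open>p ^ card S\<close>.\<close>
  define F where "F a = (\<lambda>i\<in>{..<?r}. (\<Sum>s\<in>S. a s * s i) mod int p)" for a
  let ?A = "\<Pi>\<^sub>E s\<in>S. {0..<int p}" and ?B = "\<Pi>\<^sub>E i\<in>{..<?r}. {0..<int p}"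
  have "?B \<subseteq> F ` ?A"
  proof
    fix x assume x: "x \<in> ?B"
    \<comment> \<open>Since \<open>p\<close> is at most every order, vectors with entries below
      \<open>p\<close> are elements of the group.\<close>
    have "x i < int (ns ! i)" if "i < ?r" for i
    proof -
      have "x i < int p" using PiE_mem[OF x] that by auto
      also have "int p \<le> int (ns ! i)"
        using pos nth_mem[OF that] dvd[OF that] by (intro zdvd_imp_le) auto
      finally show ?thesis .
    qed
    then have "x \<in> carrier ?G"
      using x by (simp add: carrier_cyclic_sum[OF pos] PiE_iff)
    then obtain a where a: "\<forall>i<?r. [x i = (\<Sum>s\<in>S. a s * s i)] (mod int p)"
      using word[of x] S(4) by blast
    define b where "b = (\<lambda>s\<in>S. a s mod int p)"
    have "F b = x"
    proof (rule PiE_ext)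
      show "F b \<in> ?B" using p(1) by (simp add: F_def)
      fix i assume i: "i \<in> {..<?r}"
      have "[(\<Sum>s\<in>S. b s * s i) = (\<Sum>s\<in>S. a s * s i)] (mod int p)"
        by (intro cong_sum cong_mult cong_refl) (simp add: b_def cong_def)
      moreover have "x i mod int p = x i" using PiE_mem[OF x i] by simp
      ultimately show "F b i = x i" using a i by (simp add: F_def cong_def)
    qed (rule x)
    moreover have "b \<in> ?A" using p(1) by (simp add: b_def)
    ultimately show "x \<in> F ` ?A" by blast
  qed
  then have "card ?B \<le> card (F ` ?A)"
    using S(2) by (intro card_mono) (auto intro: finite_PiE)
  also have "\<dots> \<le> card ?A" using S(2) by (intro card_image_le) (auto intro: finite_PiE)
  finally have "p ^ ?r \<le> p ^ card S" using S(2) by (simp add: card_PiE)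
  then show ?thesis using p(1) S(3) by simp
qed

lemma rank_cyclic_sum:
  assumes "\<forall>n\<in>set ns. 0 < n" "1 < p" "\<forall>n\<in>set ns. p dvd n"
  shows "rank (cyclic_sum ns) = length ns"
proof (rule order_antisym)
  have "1 < n" if "n \<in> set ns" for n
  proof -
    have "p \<le> n" using assms that by (intro dvd_imp_le) auto
    then show ?thesis using assms(2) by simp
  qed
  then show "rank (cyclic_sum ns) \<le> length ns" by (simp add: rank_cyclic_sum_le)
qed (use assms in \<open>rule rank_cyclic_sum_ge\<close>)

section \<open>Torsion counts and the uniqueness of the invariant factors\<close>

lemma card_annihilator:
  fixes n k :: nat
  assumes "0 < n"
  shows "card {x \<in> {0..<int n}. int n dvd int k * x} = gcd k n"
proof -
  define g where "g = gcd k n"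
  define c where "c = k div g"
  define d where "d = n div g"
  have g: "0 < g" and n: "n = g * d" and k: "k = g * c"
    using assms by (simp_all add: g_def c_def d_def)
  have d: "0 < d" using assms n by simp
  have cop: "coprime (int d) (int c)"
    using div_gcd_coprime[of k n] assms by (simp add: c_def d_def g_def coprime_commute)
  have dvd_iff: "int n dvd int k * x \<longleftrightarrow> int d dvd x" for x
  proof -
    have "int n dvd int k * x \<longleftrightarrow> int g * int d dvd int g * (int c * x)"
      by (simp add: n k mult.assoc)
    also have "\<dots> \<longleftrightarrow> int d dvd x"
      using g coprime_dvd_mult_right_iff[OF cop, of x] by simp
    finally show ?thesis .
  qed
  \<comment> \<open>After cancelling \<open>g\<close> and the coprime factor \<open>c\<close>, the
    solutions are the multiples of \<open>d\<close>, of which \<open>g\<close> lie below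
    \<open>n = g * d\<close>.\<close>
  have "{x \<in> {0..<int n}. int n dvd int k * x} = (\<lambda>j. int d * j) ` {0..<int g}"
  proof (intro equalityI subsetI)
    fix x assume "x \<in> {x \<in> {0..<int n}. int n dvd int k * x}"
    then have "0 \<le> x" "x < int n" "int d dvd x" by (auto simp: dvd_iff)
    then obtain j where j: "x = int d * j" by (elim dvdE)
    have "0 \<le> j" using \<open>0 \<le> x\<close> d by (simp add: j zero_le_mult_iff)
    moreover have "j < int g" using \<open>x < int n\<close> d by (simp add: j n mult.commute[of "int g"])
    ultimately show "x \<in> (\<lambda>j. int d * j) ` {0..<int g}"
      using j by (intro image_eqI[of _ _ j]) simp_all
  next
    fix x assume "x \<in> (\<lambda>j. int d * j) ` {0..<int g}"
    then obtain j where "x = int d * j" "j \<in> {0..<int g}" by blast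
    then have j: "x = int d * j" "0 \<le> j" "j < int g" by auto
    then have "int d * j < int d * int g" using d by simp
    then show "x \<in> {x \<in> {0..<int n}. int n dvd int k * x}"
      unfolding dvd_iff using j by (simp add: n mult.commute)
  qed
  moreover have "inj_on (\<lambda>j. int d * j) {0..<int g}" using d by (simp add: inj_on_def)
  ultimately show ?thesis by (simp add: card_image g_def)
qed

text \<open>The cardinalities of these sets are invariants fine enough to recover the invariant
  factors. For \<open>k = 0\<close> the set is the whole carrier, so the group order is among
  them.\<close>

definition torsion :: "('a, 'b) monoid_scheme \<Rightarrow> nat \<Rightarrow> 'a set" where
  "torsion G k = {x \<in> carrier G. x [^]\<^bsub>G\<^esub> k = \<one>\<^bsub>G\<^esub>}"

lemma card_torsion_cyclic_sum:
  assumes pos: "\<forall>n\<in>set ns. 0 < n"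
  shows "card (torsion (cyclic_sum ns) k) = prod_list (map (gcd k) ns)"
proof -
  let ?G = "cyclic_sum ns" and ?A = "\<lambda>i. {x \<in> {0..<int (ns ! i)}. int (ns ! i) dvd int k * x}"
  interpret comm_group ?G by (rule comm_group_cyclic_sum)
  have "x [^]\<^bsub>?G\<^esub> k = \<one>\<^bsub>?G\<^esub> \<longleftrightarrow> (\<forall>i<length ns. int (ns ! i) dvd int k * x i)"
    if "x \<in> carrier ?G" for x
  proof
    assume "x [^]\<^bsub>?G\<^esub> k = \<one>\<^bsub>?G\<^esub>"
    then show "\<forall>i<length ns. int (ns ! i) dvd int k * x i"
      using pow_cyclic_sum[OF that, of _ k] by (auto simp: one_cyclic_sum mod_eq_0_iff_dvd)
  next
    assume "\<forall>i<length ns. int (ns ! i) dvd int k * x i"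
    then show "x [^]\<^bsub>?G\<^esub> k = \<one>\<^bsub>?G\<^esub>"
      using that pow_cyclic_sum[OF that, of _ k]
      by (intro cyclic_sum_eqI[OF _ one_closed]) (auto simp: one_cyclic_sum)
  qed
  then have "torsion ?G k = {x \<in> carrier ?G. \<forall>i<length ns. int (ns ! i) dvd int k * x i}"
    by (auto simp: torsion_def)
  also have "\<dots> = (\<Pi>\<^sub>E i\<in>{..<length ns}. ?A i)"
    unfolding carrier_cyclic_sum[OF pos] set_eq_iff PiE_iff mem_Collect_eq Ball_def lessThan_iff
    by blast
  finally have "card (torsion ?G k) = (\<Prod>i<length ns. card (?A i))"
    by (simp add: card_PiE)
  also have "\<dots> = (\<Prod>i<length ns. gcd k (ns ! i))"
    using pos by (intro prod.cong refl card_annihilator) auto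
  also have "\<dots> = prod_list (map (gcd k) ns)"
    by (simp add: prod.list_conv_set_nth atLeast0LessThan)
  finally show ?thesis .
qed

lemma card_torsion_iso:
  assumes "group G" "group H" "G \<cong> H"
  shows "card (torsion G k) = card (torsion H k)"
proof -
  obtain \<phi> where \<phi>: "\<phi> \<in> hom G H" "bij_betw \<phi> (carrier G) (carrier H)"
    using assms(3) by (auto simp: is_iso_def iso_def)
  interpret group_hom G H \<phi>
    using assms \<phi> by (simp add: group_hom_def group_hom_axioms_def)
  have inj: "inj_on \<phi> (carrier G)" and img: "\<phi> ` carrier G = carrier H"
    using \<phi>(2) by (auto simp: bij_betw_def)
  have iff: "\<phi> x [^]\<^bsub>H\<^esub> k = \<one>\<^bsub>H\<^esub> \<longleftrightarrow> x [^]\<^bsub>G\<^esub> k = \<one>\<^bsub>G\<^esub>" if "x \<in> carrier G" for x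
    using inj_on_eq_iff[OF inj, of "x [^]\<^bsub>G\<^esub> k" "\<one>\<^bsub>G\<^esub>"] that by (simp add: hom_nat_pow)
  have "torsion H k = \<phi> ` torsion G k"
    unfolding torsion_def img[symmetric] using iff by auto
  moreover have "inj_on \<phi> (torsion G k)"
    using inj by (rule inj_on_subset) (simp add: torsion_def)
  ultimately show ?thesis by (simp add: card_image)
qed

lemma prod_list_gcd_le:
  fixes ns :: "nat list"
  assumes "\<forall>n\<in>set ns. 0 < n"
  shows "prod_list (map (gcd k) ns) \<le> prod_list ns"
  using assms by (induction ns) (auto intro!: mult_le_mono gcd_le2_nat)

text \<open>No \<open>gcd\<close> exceeds its entry, so for positive entries equality of the
  products forces equality in each factor, in particular \<open>gcd k n = n\<close>.\<close>

lemma prod_list_gcd_snoc_dvd: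
  fixes ns :: "nat list"
  assumes "\<forall>x\<in>set (ns @ [n]). 0 < x" "prod_list (map (gcd k) (ns @ [n])) = prod_list (ns @ [n])"
  shows "n dvd k"
proof (rule ccontr)
  assume "\<not> n dvd k"
  then have "gcd k n \<noteq> n" by (metis gcd_dvd1)
  moreover have "gcd k n \<le> n" using assms(1) by (intro dvd_imp_le) auto
  ultimately have "gcd k n < n" by simp
  moreover have "0 < prod_list ns" "0 < prod_list (map (gcd k) ns)"
    using assms(1) by (induction ns) auto
  ultimately have "prod_list (map (gcd k) ns) * gcd k n < prod_list ns * n"
    using prod_list_gcd_le[of ns k] assms(1) by (intro mult_le_less_imp_less) auto
  then show False using assms(2) by simp
qed

text \<open>Taking for \<open>k\<close> the last entry of one list leaves that list unchanged under
  \<open>gcd k\<close>, so \<open>prod_list_gcd_snoc_dvd\<close> makes \<open>k\<close> a multiple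
  of the last entry of the other list. By symmetry the last entries agree, and cancelling them
  permits induction.\<close>

lemma prod_list_gcd_determines:
  fixes ns ns' :: "nat list"
  assumes "sorted_wrt (dvd) ns" "sorted_wrt (dvd) ns'" "\<forall>n\<in>set ns. 1 < n" "\<forall>n\<in>set ns'. 1 < n"
    and "\<And>k. prod_list (map (gcd k) ns) = prod_list (map (gcd k) ns')"
  shows "ns = ns'"
  using assms
proof (induction ns arbitrary: ns' rule: rev_induct)
  case Nil
  show ?case
  proof (cases ns' rule: rev_cases)
    case (snoc ys y)
    \<comment> \<open>For \<open>k = 0\<close> the products are those of the entries themselves, and
      among lists of entries above 1 only the empty one has product 1.\<close>
    then show ?thesis using Nil.prems(4) Nil.prems(5)[of 0] by (auto simp: nat_mult_eq_1_iff)
  qed simp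
next
  case (snoc n xs)
  show ?case
  proof (cases ns' rule: rev_cases)
    case Nil
    then show ?thesis using snoc.prems(3) snoc.prems(5)[of 0] by (auto simp: nat_mult_eq_1_iff)
  next
    case (snoc ys n')
    note prems = snoc.prems[unfolded snoc]
    have all: "prod_list (map (gcd l) (zs @ [l])) = prod_list (zs @ [l])"
      if "sorted_wrt (dvd) (zs @ [l])" for zs and l :: nat
    proof -
      have "map (gcd l) (zs @ [l]) = zs @ [l]"
        using that by (intro map_idI) (auto simp: sorted_wrt_append gcd_nat.absorb2)
      then show ?thesis by simp
    qed
    have eq: "prod_list (xs @ [n]) = prod_list (ys @ [n'])"
      using prems(5)[of 0] by simp
    have "n' dvd n"
    proof (rule prod_list_gcd_snoc_dvd)
      show "\<forall>x\<in>set (ys @ [n']). 0 < x" using prems(4) by force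
      show "prod_list (map (gcd n) (ys @ [n'])) = prod_list (ys @ [n'])"
        unfolding prems(5)[of n, symmetric] all[OF prems(1)] by (rule eq)
    qed
    moreover have "n dvd n'"
    proof (rule prod_list_gcd_snoc_dvd)
      show "\<forall>x\<in>set (xs @ [n]). 0 < x" using prems(3) by force
      show "prod_list (map (gcd n') (xs @ [n])) = prod_list (xs @ [n])"
        unfolding prems(5)[of n'] all[OF prems(2)] by (rule eq[symmetric])
    qed
    ultimately have "n = n'" by (rule dvd_antisym[rotated])
    moreover have "xs = ys"
    proof (rule snoc.IH)
      show "prod_list (map (gcd k) xs) = prod_list (map (gcd k) ys)" for k
        using prems(3) prems(5)[of k] \<open>n = n'\<close> by simp
    qed (use prems in \<open>auto simp: sorted_wrt_append\<close>)
    ultimately show ?thesis using snoc by simp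
  qed
qed

lemma is_invariant_factors_unique:
  assumes "group G" "is_invariant_factors G ns" "is_invariant_factors G ns'"
  shows "ns = ns'"
proof (rule prod_list_gcd_determines)
  have grp: "group (cyclic_sum l)" for l
    using comm_group_cyclic_sum by (rule comm_group.axioms)
  fix k
  have "prod_list (map (gcd k) l) = card (torsion G k)" if l: "is_invariant_factors G l" for l
  proof -
    have "\<forall>n\<in>set l. 0 < n" using l by (auto simp: is_invariant_factors_def)
    then show ?thesis
      using card_torsion_iso[OF assms(1) grp[of l], of k] l
      by (simp add: is_invariant_factors_def card_torsion_cyclic_sum)
  qed
  then show "prod_list (map (gcd k) ns) = prod_list (map (gcd k) ns')"
    using assms by simp
qed (use assms in \<open>auto simp: is_invariant_factors_def\<close>)

text \<open>Uniqueness of the invariant factors makes the definite description denote the given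
  list.\<close>

lemma d_star_eq:
  assumes "group G" "is_invariant_factors G ns"
  shows "d_star G = (\<Sum>n\<leftarrow>ns. n - 1)"
proof -
  have "(THE ns. is_invariant_factors G ns) = ns"
    by (rule the_equality) (use assms is_invariant_factors_unique in blast)+
  then show ?thesis by (simp add: d_star_def)
qed

subsection \<open>The long sequence\<close>

text \<open>
  The counts \<open>a0\<close>, \<dots>, \<open>b3\<close> are multiples of \<open>m\<close> below \<open>2m\<close>, so dividing by \<open>m\<close> gives bits; the
  parity conditions say that they form a word of the simplex code, all of whose nonzero words have
  weight 4. The last condition then asks for a multiple of 6 among \<open>0, \<dots>, 3\<close> or \<open>8, \<dots>, 11\<close>.
\<close>

lemma simplex_code_zero:
  fixes a0 a1 a2 b0 b1 b2 b3 c m :: nat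
  assumes m: "0 < m"
    and bound: "a0 < 2 * m" "a1 < 2 * m" "a2 < 2 * m" "b0 < 2 * m" "b1 < 2 * m" "b2 < 2 * m" "b3 < 2 * m"
      "c < 4 * m"
    and dvd: "m dvd a0" "m dvd a1" "m dvd a2"
      "2 * m dvd b0 + a0 + a1 + a2" "2 * m dvd b1 + a0 + a1" "2 * m dvd b2 + a0 + a2"
      "2 * m dvd b3 + a1 + a2" "6 * m dvd c + 2 * (a0 + a1 + a2 + b0 + b1 + b2 + b3)"
  shows "a0 = 0 \<and> a1 = 0 \<and> a2 = 0 \<and> b0 = 0 \<and> b1 = 0 \<and> b2 = 0 \<and> b3 = 0 \<and> c = 0"
proof -
  \<comment> \<open>The conditions modulo \<open>2 * m\<close> and \<open>6 * m\<close> are first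
    used modulo \<open>m\<close> only, to see that the remaining counts are multiples of
    \<open>m\<close> as well.\<close>
  have m_dvd: "m dvd y" if "k * m dvd y + z" "m dvd z" for k y z :: nat
    using that by (metis dvd_add_left_iff dvd_mult_right)
  have b: "m dvd b0" "m dvd b1" "m dvd b2" "m dvd b3"
    using m_dvd[of 2 b0 "a0 + a1 + a2"] m_dvd[of 2 b1 "a0 + a1"] m_dvd[of 2 b2 "a0 + a2"]
      m_dvd[of 2 b3 "a1 + a2"] dvd by (simp_all add: add.assoc)
  have c: "m dvd c"
    using m_dvd[of 6 c "2 * (a0 + a1 + a2 + b0 + b1 + b2 + b3)"] dvd b
    by (meson dvd_add dvd_mult)
  obtain x0 x1 x2 y0 y1 y2 y3 z where eqs: "a0 = m * x0" "a1 = m * x1" "a2 = m * x2"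
      "b0 = m * y0" "b1 = m * y1" "b2 = m * y2" "b3 = m * y3" "c = m * z"
    using dvd(1-3) b c by (elim dvdE)
  have cancel: "m * x < k * m \<longleftrightarrow> x < k" "k * m dvd m * x \<longleftrightarrow> k dvd x" for x k :: nat
    using m by (simp_all add: mult.commute)
  have bits: "x0 < 2" "x1 < 2" "x2 < 2" "y0 < 2" "y1 < 2" "y2 < 2" "y3 < 2" "z < 4"
    using bound by (simp_all only: eqs cancel)
  have par: "2 dvd y0 + x0 + x1 + x2" "2 dvd y1 + x0 + x1" "2 dvd y2 + x0 + x2" "2 dvd y3 + x1 + x2"
    using dvd(4-7) by (simp_all only: eqs cancel flip: distrib_left)
  have "6 * m dvd m * (z + 2 * (x0 + x1 + x2 + y0 + y1 + y2 + y3))"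
    using dvd(8) by (simp add: eqs algebra_simps)
  then have six: "6 dvd z + 2 * (x0 + x1 + x2 + y0 + y1 + y2 + y3)"
    by (simp only: cancel)
  have "x0 = 0 \<and> x1 = 0 \<and> x2 = 0 \<and> y0 = 0 \<and> y1 = 0 \<and> y2 = 0 \<and> y3 = 0 \<and> z = 0"
  proof -
    \<comment> \<open>Parity determines the check bits \<open>y0\<close>, ..., \<open>y3\<close>
      from \<open>x0\<close>, \<open>x1\<close>, \<open>x2\<close>; together with the values of
      \<open>z\<close> this leaves 32 cases to test against \<open>six\<close>.\<close>
    have y: "y0 = (x0 + x1 + x2) mod 2" "y1 = (x0 + x1) mod 2" "y2 = (x0 + x2) mod 2" "y3 = (x1 + x2) mod 2"
      using par bits(4-7) by presburger+
    have "x0 = 0 \<or> x0 = 1" "x1 = 0 \<or> x1 = 1" "x2 = 0 \<or> x2 = 1"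
      "z = 0 \<or> z = 1 \<or> z = 2 \<or> z = 3"
      using bits by auto
    then show ?thesis using six[unfolded y] by (elim disjE) (simp_all add: y)
  qed
  then show ?thesis by (simp add: eqs)
qed

text \<open>
  The columns of the map \<open>\<int>\<^sup>r \<rightarrow> G_mr m r\<close> with kernel \<open>mL\<close>, for \<open>r = t + 8\<close>: the coordinates below
  \<open>t + 3\<close> belong to the summands of order \<open>m\<close>, the next four to those of order \<open>2m\<close>, the last to the
  one of order \<open>6m\<close>. The columns 0, 1, 2 and \<open>t + 3\<close>, \<dots>, \<open>t + 6\<close> carry the seven columns of a
  generator matrix of the Hamming code, the columns 3, \<dots>, \<open>t + 2\<close> only raise the rank.
\<close>

definition seq_term :: "nat \<Rightarrow> nat \<Rightarrow> nat \<Rightarrow> int" where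
  "seq_term t j i =
    (if i = j then 1
     else if i = t + 7 \<and> (j < 3 \<or> t + 3 \<le> j) then 2
     else if (j, i) \<in> {(0, t + 3), (0, t + 4), (0, t + 5), (1, t + 3), (1, t + 4), (1, t + 6),
       (2, t + 3), (2, t + 5), (2, t + 6)} then 1
     else 0)"

text \<open>The bounds \<open>m * c + m - 1\<close> of the enlarged box, where \<open>c\<close> is
  the multiplicity in the sequence over \<open>Q\<close>: 3 for the element \<open>(0, 1)\<close>, 1
  for the seven terms from the code, 0 for the added zeros.\<close>

definition seq_mult :: "nat \<Rightarrow> nat \<Rightarrow> nat \<Rightarrow> nat" where
  "seq_mult m t j = (if j = t + 7 then 4 * m - 1 else if j < 3 \<or> t + 3 \<le> j then 2 * m - 1 else m - 1)"

text \<open>Isolates the eight columns that carry the sequence over \<open>Q\<close> from the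
  \<open>t\<close> columns in the middle.\<close>

lemma sum_lessThan_split:
  fixes t :: nat and f :: "nat \<Rightarrow> 'a :: comm_monoid_add"
  shows "(\<Sum>j<t + 8. f j) = f 0 + f 1 + f 2 + (\<Sum>j<t. f (j + 3))
     + f (t + 3) + f (t + 4) + f (t + 5) + f (t + 6) + f (t + 7)"
proof -
  have "(\<Sum>j<t + 3. f j) = f 0 + f 1 + f 2 + (\<Sum>j<t. f (j + 3))"
    by (induction t) (auto simp: numeral_eq_Suc add.assoc)
  moreover have "(\<Sum>j<t + 8. f j)
      = (\<Sum>j<t + 3. f j) + f (t + 3) + f (t + 4) + f (t + 5) + f (t + 6) + f (t + 7)"
    by (simp add: numeral_eq_Suc)
  ultimately show ?thesis by simp
qed

lemma G_mr_eq: "G_mr m (t + 8) = cyclic_sum (replicate (t + 3) m @ replicate 4 (2 * m) @ [6 * m])"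
  by (simp add: G_mr_def add.commute)

lemma nth_factors:
  assumes "i < t + 8"
  shows "(replicate (t + 3) m @ replicate 4 (2 * m) @ [6 * m]) ! i =
    (if i < t + 3 then m else if i < t + 7 then 2 * m else 6 * m)"
  using assms by (auto simp: nth_append nth_Cons split: nat.split)

text \<open>The coordinates of a zero sum supply the hypotheses of \<open>simplex_code_zero\<close>
  for the eight distinguished counts, which must therefore vanish; each remaining count is a
  multiple of \<open>m\<close> below \<open>m\<close>.\<close>

lemma zero_sum_free_G_mr:
  assumes m: "2 \<le> m"
  shows "zero_sum_free (G_mr m (t + 8))
    (\<Sum>j<t + 8. replicate_mset (seq_mult m t j) (\<lambda>i\<in>{..<t + 8}. seq_term t j i))"
  unfolding G_mr_eq
proof (rule zero_sum_free_cyclic_sum)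
  let ?ns = "replicate (t + 3) m @ replicate 4 (2 * m) @ [6 * m]"
  have len: "length ?ns = t + 8" by simp
  fix j
  \<comment> \<open>An entry 2 occurs only in the last coordinate, of order \<open>6 * m\<close>,
    and an entry 1 is reduced everywhere because \<open>m\<close> is at least 2.\<close>
  have "0 \<le> seq_term t j i \<and> seq_term t j i < int (?ns ! i)" if "i < t + 8" for i
    unfolding nth_factors[OF that] using m by (auto simp: seq_term_def)
  then show "(\<lambda>i\<in>{..<t + 8}. seq_term t j i) \<in> carrier (cyclic_sum ?ns)"
    using m by (subst carrier_cyclic_sum) (auto simp: len)
next
  let ?ns = "replicate (t + 3) m @ replicate 4 (2 * m) @ [6 * m]"
  fix a :: "nat \<Rightarrow> nat"
  assume bound: "\<forall>j<t + 8. a j \<le> seq_mult m t j"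
    and "\<forall>i<length ?ns. int (?ns ! i) dvd (\<Sum>j<t + 8. int (a j) * (\<lambda>i\<in>{..<t + 8}. seq_term t j i) i)"
  then have dvd: "int (?ns ! i) dvd (\<Sum>j<t + 8. int (a j) * seq_term t j i)" if "i < t + 8" for i
    using that by simp
  have m_dvd: "m dvd a i" if "i < t + 3" for i
  proof -
    \<comment> \<open>Coordinate \<open>i\<close> is nonzero in column \<open>i\<close>
      only.\<close>
    have "(\<Sum>j<t + 8. int (a j) * seq_term t j i) = (\<Sum>j<t + 8. if j = i then int (a j) else 0)"
      using that by (intro sum.cong) (auto simp: seq_term_def)
    then have "(\<Sum>j<t + 8. int (a j) * seq_term t j i) = int (a i)"
      using that by simp
    then show ?thesis using dvd[of i] that nth_factors[of i t m] by simp
  qed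
  have dvd3: "2 * m dvd a (t + 3) + a 0 + a 1 + a 2"
  proof -
    have "(\<Sum>j<t + 8. int (a j) * seq_term t j (t + 3)) = int (a (t + 3) + a 0 + a 1 + a 2)"
      unfolding sum_lessThan_split by (simp add: seq_term_def)
    then show ?thesis using dvd[of "t + 3"] nth_factors[of "t + 3" t m] by (simp only: of_nat_dvd_iff) simp
  qed
  have dvd4: "2 * m dvd a (t + 4) + a 0 + a 1"
  proof -
    have "(\<Sum>j<t + 8. int (a j) * seq_term t j (t + 4)) = int (a (t + 4) + a 0 + a 1)"
      unfolding sum_lessThan_split by (simp add: seq_term_def)
    then show ?thesis using dvd[of "t + 4"] nth_factors[of "t + 4" t m] by (simp only: of_nat_dvd_iff) simp
  qed
  have dvd5: "2 * m dvd a (t + 5) + a 0 + a 2"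
  proof -
    have "(\<Sum>j<t + 8. int (a j) * seq_term t j (t + 5)) = int (a (t + 5) + a 0 + a 2)"
      unfolding sum_lessThan_split by (simp add: seq_term_def)
    then show ?thesis using dvd[of "t + 5"] nth_factors[of "t + 5" t m] by (simp only: of_nat_dvd_iff) simp
  qed
  have dvd6: "2 * m dvd a (t + 6) + a 1 + a 2"
  proof -
    have "(\<Sum>j<t + 8. int (a j) * seq_term t j (t + 6)) = int (a (t + 6) + a 1 + a 2)"
      unfolding sum_lessThan_split by (simp add: seq_term_def)
    then show ?thesis using dvd[of "t + 6"] nth_factors[of "t + 6" t m] by (simp only: of_nat_dvd_iff) simp
  qed
  have dvd7: "6 * m dvd a (t + 7) + 2 * (a 0 + a 1 + a 2 + a (t + 3) + a (t + 4) + a (t + 5) + a (t + 6))"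
  proof -
    have "(\<Sum>j<t + 8. int (a j) * seq_term t j (t + 7))
      = int (a (t + 7) + 2 * (a 0 + a 1 + a 2 + a (t + 3) + a (t + 4) + a (t + 5) + a (t + 6)))"
      unfolding sum_lessThan_split by (simp add: seq_term_def)
    then show ?thesis using dvd[of "t + 7"] nth_factors[of "t + 7" t m] by (simp only: of_nat_dvd_iff) simp
  qed
  have bounds: "a 0 < 2 * m" "a 1 < 2 * m" "a 2 < 2 * m" "a (t + 3) < 2 * m" "a (t + 4) < 2 * m"
    "a (t + 5) < 2 * m" "a (t + 6) < 2 * m" "a (t + 7) < 4 * m"
    using bound[rule_format, of 0] bound[rule_format, of 1] bound[rule_format, of 2]
      bound[rule_format, of "t + 3"] bound[rule_format, of "t + 4"] bound[rule_format, of "t + 5"]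
      bound[rule_format, of "t + 6"] bound[rule_format, of "t + 7"] m
    by (simp_all add: seq_mult_def)
  have main: "a 0 = 0 \<and> a 1 = 0 \<and> a 2 = 0 \<and> a (t + 3) = 0 \<and> a (t + 4) = 0 \<and> a (t + 5) = 0
      \<and> a (t + 6) = 0 \<and> a (t + 7) = 0"
    using m by (intro simplex_code_zero[of m] m_dvd bounds dvd3 dvd4 dvd5 dvd6 dvd7) auto
  have rest: "a i = 0" if "3 \<le> i" "i < t + 3" for i
  proof -
    have "a i < m" using bound[rule_format, of i] that m by (simp add: seq_mult_def)
    then show ?thesis using m_dvd[OF that(2)] by (auto dest: dvd_imp_le)
  qed
  show "\<forall>j<t + 8. a j = 0"
  proof (intro allI impI)
    fix j assume "j < t + 8"
    then consider "j = 0" | "j = 1" | "j = 2" | "3 \<le> j" "j < t + 3" | "j = t + 3" | "j = t + 4"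
      | "j = t + 5" | "j = t + 6" | "j = t + 7" by linarith
    then show "a j = 0" using main rest by cases auto
  qed
qed

section \<open>Length of the sequence, rank and excess\<close>

lemma size_seq_G_mr:
  "size (\<Sum>j<t + 8. replicate_mset (seq_mult m t j) (w j)) = 7 * (2 * m - 1) + (4 * m - 1) + t * (m - 1)"
proof -
  have "size (\<Sum>j<k. replicate_mset (M j) (w j)) = (\<Sum>j<k. M j)" for k and M :: "nat \<Rightarrow> nat"
    by (induction k) auto
  then have "size (\<Sum>j<t + 8. replicate_mset (seq_mult m t j) (w j)) = (\<Sum>j<t + 8. seq_mult m t j)" .
  also have "\<dots> = 7 * (2 * m - 1) + (4 * m - 1) + t * (m - 1)"
    unfolding sum_lessThan_split by (simp add: seq_mult_def)
  finally show ?thesis .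
qed

lemma is_invariant_factors_G_mr:
  assumes "2 \<le> m"
  shows "is_invariant_factors (G_mr m (t + 8)) (replicate (t + 3) m @ replicate 4 (2 * m) @ [6 * m])"
proof -
  have "sorted_wrt (dvd) (replicate k n)" for k and n :: nat
    by (induction k) auto
  then show ?thesis
    using assms by (auto simp: is_invariant_factors_def G_mr_eq sorted_wrt_append)
qed

text \<open>Stated up to isomorphism, to serve both \<open>G_mr m r\<close> itself and its copy in
  \<open>fin_ab_groups\<close>.\<close>

lemma rank_excess_of_iso_G_mr:
  assumes H: "comm_group H" "finite (carrier H)" and iso: "G_mr m r \<cong> H" and m: "2 \<le> m" and r: "8 \<le> r"
  shows "rank H = r" "int m \<le> davenport_excess H"
proof -
  obtain t where t: "r = t + 8" using r le_Suc_ex[of 8 r] by (auto simp: add.commute)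
  interpret H: comm_group H by fact
  let ?G = "G_mr m (t + 8)" and ?ns = "replicate (t + 3) m @ replicate 4 (2 * m) @ [6 * m]"
  have G: "comm_group ?G" unfolding G_mr_eq by (rule comm_group_cyclic_sum)
  then interpret G: comm_group ?G .
  have fin: "finite (carrier ?G)"
    unfolding G_mr_eq using m by (intro finite_cyclic_sum) auto
  have GH: "?G \<cong> H" using iso by (simp add: t)
  have "rank ?G = length ?ns"
    unfolding G_mr_eq using m by (intro rank_cyclic_sum[of _ m]) auto
  then show "rank H = r"
    using rank_iso[OF G.is_group H.is_group GH fin] by (simp add: t)
  have "is_invariant_factors H ?ns"
    by (rule is_invariant_factors_iso[OF G.is_group H.is_group GH, THEN iffD1])
      (rule is_invariant_factors_G_mr[OF m])
  then have "d_star H = (\<Sum>n\<leftarrow>?ns. n - 1)" by (rule d_star_eq[OF H.is_group])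
  then have d: "d_star H = (t + 3) * (m - 1) + 4 * (2 * m - 1) + (6 * m - 1)"
    by (simp add: sum_list_replicate)
  obtain \<phi> where \<phi>: "\<phi> \<in> iso ?G H" using GH by (auto simp: is_iso_def)
  have "7 * (2 * m - 1) + (4 * m - 1) + t * (m - 1) \<le> small_davenport H"
    using H.small_davenport_ge[OF H(2) zero_sum_free_image_iso[OF G H(1) \<phi> zero_sum_free_G_mr[OF m]]]
    by (simp only: size_image_mset size_seq_G_mr)
  then have "int (7 * (2 * m - 1) + (4 * m - 1) + t * (m - 1)) \<le> int (small_davenport H)"
    by (simp only: of_nat_le_iff)
  \<comment> \<open>Both sides equal \<open>(t + 18) * m - (t + 8)\<close>. Writing
    \<open>m = Suc k\<close> removes the truncated subtractions.\<close>
  moreover have "int (7 * (2 * m - 1) + (4 * m - 1) + t * (m - 1)) = int (d_star H) + int m"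
  proof -
    obtain k where "m = Suc k" using m by (cases m) auto
    then show ?thesis unfolding d by (simp add: algebra_simps)
  qed
  ultimately show "int m \<le> davenport_excess H" by (simp add: davenport_excess_def)
qed

lemma ex_fin_ab_group_excess_ge:
  assumes "8 \<le> r"
  shows "\<exists>G\<in>fin_ab_groups. rank G = r \<and> \<not> trivial_group G \<and> int n \<le> davenport_excess G"
proof -
  \<comment> \<open>Large enough for an excess of \<open>n\<close>, and at least 2 even for
    \<open>n = 0\<close>.\<close>
  let ?m = "n + 2"
  have G: "comm_group (G_mr ?m r)" unfolding G_mr_def by (rule comm_group_cyclic_sum)
  have fin: "finite (carrier (G_mr ?m r))"
    unfolding G_mr_def by (intro finite_cyclic_sum) auto
  obtain H where H: "H \<in> fin_ab_groups" "G_mr ?m r \<cong> H"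
    using finite_group_iso_nat[OF G fin] by blast
  then have "comm_group H" "finite (carrier H)" by (auto simp: fin_ab_groups_def)
  note HH = rank_excess_of_iso_G_mr[OF this H(2) _ assms]
  \<comment> \<open>A trivial group has rank 0, while \<open>H\<close> has rank at least 8.\<close>
  have "\<not> trivial_group H"
    using HH(1) assms group.rank_trivial[of H] \<open>comm_group H\<close> by (auto simp: comm_group_def)
  then show ?thesis using HH H(1) by auto
qed

theorem corollary6p1:
  shows
    "(\<forall>r::nat. r \<ge> 8 \<longrightarrow>
        (SUP G \<in> {G \<in> fin_ab_groups. rank G = r}. ereal (of_int (davenport_excess G))) = \<infinity>)
   \<and> \<not> (\<exists>f :: nat \<Rightarrow> real. (\<forall>n. 0 \<le> f n) \<and>
          (\<forall>G \<in> fin_ab_groups. \<not> trivial_group G \<longrightarrow> of_int (davenport_excess G) \<le> f (rank G)))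
   \<and> (SUP G \<in> {G \<in> fin_ab_groups. \<not> trivial_group G}.
          ereal (of_int (davenport_excess G) / of_nat (rank G))) = \<infinity>
   \<and> (SUP G \<in> {G \<in> fin_ab_groups. rank G = 8}.
          ereal (of_int (davenport_excess G) / of_nat (rank G))) = \<infinity>
   \<and> (\<forall>r m :: nat. r \<ge> 8 \<and> m \<ge> 2 \<and> m \<ge> r \<longrightarrow>
        rank (G_mr m r) = r \<and> davenport_excess (G_mr m r) > int r - 1)"
proof (intro conjI allI impI notI)
  fix r :: nat assume r: "8 \<le> r"
  show "(SUP G \<in> {G \<in> fin_ab_groups. rank G = r}. ereal (of_int (davenport_excess G))) = \<infinity>"
  proof (rule SUP_PInfty)
    fix n
    obtain G where G: "G \<in> fin_ab_groups" "rank G = r" "int n \<le> davenport_excess G"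
      using ex_fin_ab_group_excess_ge[OF r] by blast
    then have "real n \<le> of_int (davenport_excess G)" by linarith
    then show "\<exists>G\<in>{G \<in> fin_ab_groups. rank G = r}. ereal (real n) \<le> ereal (of_int (davenport_excess G))"
      using G by auto
  qed
next
  assume "\<exists>f :: nat \<Rightarrow> real. (\<forall>n. 0 \<le> f n) \<and>
    (\<forall>G \<in> fin_ab_groups. \<not> trivial_group G \<longrightarrow> of_int (davenport_excess G) \<le> f (rank G))"
  then obtain f :: "nat \<Rightarrow> real" where
    f: "\<And>G. \<lbrakk>G \<in> fin_ab_groups; \<not> trivial_group G\<rbrakk> \<Longrightarrow> of_int (davenport_excess G) \<le> f (rank G)"
    by blast
  \<comment> \<open>Groups of rank 8 suffice: \<open>f\<close> would bound all their excesses by the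
    one number \<open>f 8\<close>.\<close>
  obtain n where n: "f 8 < real n" using reals_Archimedean2 by blast
  obtain G where "G \<in> fin_ab_groups" "rank G = 8" "\<not> trivial_group G" "int n \<le> davenport_excess G"
    using ex_fin_ab_group_excess_ge[of 8 n] by auto
  then show False using f[of G] n by simp
next
  have ratio: "\<exists>G\<in>fin_ab_groups. rank G = 8 \<and> \<not> trivial_group G \<and>
      ereal (real n) \<le> ereal (of_int (davenport_excess G) / of_nat (rank G))" for n
  proof -
    \<comment> \<open>The factor 8 offsets the division by the rank.\<close>
    obtain G where "G \<in> fin_ab_groups" "rank G = 8" "\<not> trivial_group G" "int (8 * n) \<le> davenport_excess G"
      using ex_fin_ab_group_excess_ge[of 8 "8 * n"] by auto
    moreover from this have "real n \<le> of_int (davenport_excess G) / 8" by linarith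
    ultimately show ?thesis by force
  qed
  show "(SUP G \<in> {G \<in> fin_ab_groups. \<not> trivial_group G}.
      ereal (of_int (davenport_excess G) / of_nat (rank G))) = \<infinity>"
    by (rule SUP_PInfty) (use ratio in blast)
  show "(SUP G \<in> {G \<in> fin_ab_groups. rank G = 8}.
      ereal (of_int (davenport_excess G) / of_nat (rank G))) = \<infinity>"
    by (rule SUP_PInfty) (use ratio in blast)
next
  fix r m :: nat assume rm: "8 \<le> r \<and> 2 \<le> m \<and> r \<le> m"
  have G: "comm_group (G_mr m r)" unfolding G_mr_def by (rule comm_group_cyclic_sum)
  have fin: "finite (carrier (G_mr m r))"
    unfolding G_mr_def using rm by (intro finite_cyclic_sum) auto
  note * = rank_excess_of_iso_G_mr[OF G fin iso_refl]
  show "rank (G_mr m r) = r" using * rm by simp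
  show "int r - 1 < davenport_excess (G_mr m r)" using *(2) rm by linarith
qed

end
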